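(* Let $n\in\mathbb N_0$ and $b,c,d,e,f,q\in\mathbb C^*$ with $|q|\ne1$. Then (whenever no denominator occurring vanishes) $${}_4\phi_3\left(q^{-n},\frac{qb}{cd},\frac{qb}{ce},\frac{qb}{cf};\,\frac{q^2b^2}{cdef},\frac{q^{1-n}}c,\frac{qb}c;\,q,q\right)$$ $$=\frac{\left(\frac{qb}d,d;q\right)_n}{\left(\frac{qb}c,c;q\right)_n}\,{}_4\phi_3\left(q^{-n},\frac{qb}{dc},\frac{qb}{de},\frac{qb}{df};\,\frac{q^2b^2}{cdef},\frac{q^{1-n}}d,\frac{qb}d;\,q,q\right)$$ $$=\frac{\left(\frac{qb}e,e;q\right)_n}{\left(\frac{qb}c,c;q\right)_n}\,{}_4\phi_3\left(q^{-n},\frac{qb}{ec},\frac{qb}{ed},\frac{qb}{ef};\,\frac{q^2b^2}{cdef},\frac{q^{1-n}}e,\frac{qb}e;\,q,q\right)$$ $$=\frac{\left(\frac{qb}f,f;q\right)_n}{\left(\frac{qb}c,c;q\right)_n}\,{}_4\phi_3\left(q^{-n},\frac{qb}{fc},\frac{qb}{fd},\frac{qb}{fe};\,\frac{q^2b^2}{cdef},\frac{q^{1-n}}f,\frac{qb}f;\,q,q\right).$$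
   Context: $\mathbb N_0=\{0,1,2,\ldots\}$, $\mathbb C^*=\mathbb C\setminus\{0\}$; $e$ is a parameter, not Euler's number. The $q$-Pochhammer symbol is $(a;q)_n=(1-a)(1-aq)\cdots(1-aq^{n-1})$ (empty product equal to $1$), and $(a_1,\ldots,a_k;q)_n=(a_1;q)_n\cdots(a_k;q)_n$. The terminating series is $${}_4\phi_3(q^{-n},\alpha,\beta,\gamma;\,\delta,\epsilon,\zeta;\,q,z)=\sum_{k=0}^n\frac{(q^{-n},\alpha,\beta,\gamma;q)_k}{(q,\delta,\epsilon,\zeta;q)_k}z^k.$$ Standing convention: denominator parameters of a terminating series avoid $\{q^{-k}:0\le k\le n-1\}$, so that no denominator vanishes. *)

theory Defs
  imports Complex_Main
begin

definition qpoch :: "complex \<Rightarrow> complex \<Rightarrow> nat \<Rightarrow> complex" where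
  "qpoch a q n = (\<Prod>i<n. 1 - a * q ^ i)"

definition qpochs :: "complex list \<Rightarrow> complex \<Rightarrow> nat \<Rightarrow> complex" where
  "qpochs as q n = (\<Prod>a\<leftarrow>as. qpoch a q n)"

(* The terminating series 4phi3(q^{-n}, \<alpha>, \<beta>, \<gamma>; \<delta>, \<epsilon>, \<zeta>; q, z); the numerator
   parameter q^{-n} is supplied by the definition through the argument n. *)
definition phi43 ::
  "nat \<Rightarrow> complex \<Rightarrow> complex \<Rightarrow> complex \<Rightarrow> complex \<Rightarrow> complex \<Rightarrow> complex \<Rightarrow> complex \<Rightarrow> complex \<Rightarrow> complex"
where
  "phi43 n \<alpha> \<beta> \<gamma> \<delta> \<epsilon> \<zeta> q z =
     (\<Sum>k\<le>n. qpochs [q powi (- int n), \<alpha>, \<beta>, \<gamma>] q k / qpochs [q, \<delta>, \<epsilon>, \<zeta>] q k * z ^ k)"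

(* Convention on the denominator parameters of a terminating series of length n.
   For q \<noteq> 0 it says that (\<delta>,\<epsilon>,\<zeta>;q)_k \<noteq> 0 for all k \<le> n; the remaining factor (q;q)_k
   never vanishes when |q| \<noteq> 1. *)
definition denominators_ok :: "nat \<Rightarrow> complex \<Rightarrow> complex \<Rightarrow> complex \<Rightarrow> complex \<Rightarrow> bool" where
  "denominators_ok n \<delta> \<epsilon> \<zeta> q \<longleftrightarrow> {\<delta>, \<epsilon>, \<zeta>} \<inter> {q powi (- int k) | k. k < n} = {}"

end

theory Submission
  imports Defs
begin

text \<open>
  The four expressions are the same balanced series up to an exchange of the parameters
  \<open>c\<close>, \<open>d\<close>, \<open>e\<close>, \<open>f\<close>, and the identities are instances of Sears' transformation. Put \<open>a = q b\<close>
  and \<open>\<delta> = a\<^sup>2 / (c d e f)\<close>. Reversing the order of the factors turns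
  \<open>q\<^sup>k (q\<^sup>-\<^sup>n; q)\<^sub>k / (q\<^sup>1\<^sup>-\<^sup>n / c; q)\<^sub>k\<close> into an expression without negative powers of \<open>q\<close>, and after
  multiplication by \<open>(a / c, c, \<delta>; q)\<^sub>n\<close> the first series becomes \<open>sears_sum q n a c d e f\<close>, in
  which the only shifted factorials in denominators are the \<open>(q; q)\<^sub>k\<close> of the Gaussian binomial
  coefficients. The first series is visibly symmetric in \<open>d\<close>, \<open>e\<close>, \<open>f\<close>, so all three identities
  reduce to the invariance of this sum under exchanging \<open>c\<close> and \<open>d\<close>.

  This follows from two uses of the terminating \<open>q\<close>-Pfaff--Saalschuetz sum, in the polynomial form
  \<open>(u A, u B; q)\<^sub>k = \<Sum>\<^sub>j [k, j] u\<^sup>j (A, B; q)\<^sub>j (u A B q\<^sup>j; q)\<^sub>k\<^sub>-\<^sub>j (u; q)\<^sub>k\<^sub>-\<^sub>j\<close>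
  with \<open>[k, j]\<close> the Gaussian binomial coefficient. The first use, with \<open>u = d / c\<close>, expands
  \<open>(a / (c e), a / (c f); q)\<^sub>k\<close>; after the two summations are interchanged, the inner sum is
  again of Saalschuetz type, with \<open>u = c\<close>, and its value yields the terms of the sum in which
  \<open>c\<close> and \<open>d\<close> are exchanged. The Saalschuetz sum itself is proved by induction on \<open>k\<close> through a
  telescoping argument: lemmas \<open>saal_term_0\<close>, \<open>saal_term_Suc\<close>, \<open>saal_term_top\<close> are a
  Pascal-type recurrence for its summand.
\<close>

section \<open>Shifted factorials and Gaussian binomial coefficients\<close>

lemma qpoch_0 [simp]: "qpoch a q 0 = 1"
  by (simp add: qpoch_def)

lemma qpoch_Suc: "qpoch a q (Suc n) = qpoch a q n * (1 - a * q ^ n)"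
  by (simp add: qpoch_def)

lemma qpoch_add: "qpoch a q (m + n) = qpoch a q m * qpoch (a * q ^ m) q n"
  by (induction n) (simp_all add: qpoch_Suc power_add mult_ac)

lemma qpoch_Suc_left: "qpoch a q (Suc n) = (1 - a) * qpoch (a * q) q n"
  using qpoch_add[of a q 1 n] by (simp add: qpoch_Suc)

lemma qpoch_split: "k \<le> n \<Longrightarrow> qpoch a q n = qpoch a q k * qpoch (a * q ^ k) q (n - k)"
  using qpoch_add[of a q k "n - k"] by simp

lemma power_ne_1_of_norm_ne_1:
  fixes q :: complex
  assumes "norm q \<noteq> 1"
  shows "q ^ Suc n \<noteq> 1"
proof
  assume "q ^ Suc n = 1"
  then have "norm q ^ Suc n = 1"
    by (metis norm_one norm_power)
  then show False
    using assms power_eq_imp_eq_base[of "norm q" "Suc n" 1] by simp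
qed

lemma qpoch_self_nonzero: "norm q \<noteq> 1 \<Longrightarrow> qpoch q q n \<noteq> 0"
  using power_ne_1_of_norm_ne_1[of q] by (auto simp: qpoch_def)

lemma qpoch_nonzero_iff:
  assumes "q \<noteq> 0"
  shows "qpoch x q n \<noteq> 0 \<longleftrightarrow> x \<notin> {q powi (- int k) | k. k < n}"
proof -
  have "1 - x * q ^ k = 0 \<longleftrightarrow> x = q powi (- int k)" for k
    using assms by (auto simp: power_int_minus field_simps)
  then show ?thesis
    by (auto simp: qpoch_def)
qed

definition qbinomial :: "complex \<Rightarrow> nat \<Rightarrow> nat \<Rightarrow> complex" where
  "qbinomial q n k = qpoch q q n / (qpoch q q k * qpoch q q (n - k))"

lemma qbinomial_0 [simp]: "norm q \<noteq> 1 \<Longrightarrow> qbinomial q n 0 = 1"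
  by (simp add: qbinomial_def qpoch_self_nonzero)

lemma qbinomial_self [simp]: "norm q \<noteq> 1 \<Longrightarrow> qbinomial q n n = 1"
  by (simp add: qbinomial_def qpoch_self_nonzero)

lemma qbinomial_mult:
  assumes "norm q \<noteq> 1"
  shows "qbinomial q n (j + i) * qbinomial q (j + i) j = qbinomial q n j * qbinomial q (n - j) i"
  using qpoch_self_nonzero[OF assms] by (simp add: qbinomial_def field_simps)

section \<open>The terminating balanced sum of Pfaff and Saalschuetz\<close>

definition saal_term :: "complex \<Rightarrow> complex \<Rightarrow> complex \<Rightarrow> complex \<Rightarrow> nat \<Rightarrow> nat \<Rightarrow> complex" where
  "saal_term q u A B k j =
     qbinomial q k j * u ^ j * qpoch A q j * qpoch B q j *
     qpoch (u * A * B * q ^ j) q (k - j) * qpoch u q (k - j)"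

text \<open>
  In passing from \<open>k\<close> to \<open>k + 1\<close> the sum is multiplied by \<open>(1 - u A q\<^sup>k) (1 - u B q\<^sup>k)\<close>. The
  following weight is the part of this factor that moves the \<open>j\<close>-th summand to position
  \<open>j + 1\<close>; the remaining part leaves it at position \<open>j\<close>. If \<open>t\<close> is the summand and \<open>G\<close> its
  Wilf--Zeilberger companion, the weight is \<open>- G (j + 1) / t j\<close>.
\<close>

definition saal_shift :: "complex \<Rightarrow> complex \<Rightarrow> complex \<Rightarrow> complex \<Rightarrow> nat \<Rightarrow> nat \<Rightarrow> complex" where
  "saal_shift q u A B k j = q ^ (k - j) * u * (1 - A * q ^ j) * (1 - B * q ^ j)"

lemma saal_term_0:
  assumes "norm q \<noteq> 1"
  shows "saal_term q u A B (Suc k) 0 =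
    ((1 - u * A * q ^ k) * (1 - u * B * q ^ k) - saal_shift q u A B k 0) * saal_term q u A B k 0"
  using assms by (simp add: saal_term_def saal_shift_def qpoch_Suc) (simp add: algebra_simps)

lemma saal_term_top:
  assumes "norm q \<noteq> 1"
  shows "saal_term q u A B (Suc k) (Suc k) = saal_shift q u A B k k * saal_term q u A B k k"
  using assms by (simp add: saal_term_def saal_shift_def qpoch_Suc)

lemma saal_term_Suc:
  assumes "norm q \<noteq> 1" and "j < k"
  shows "saal_term q u A B (Suc k) (Suc j) =
    ((1 - u * A * q ^ k) * (1 - u * B * q ^ k) - saal_shift q u A B k (Suc j))
      * saal_term q u A B k (Suc j)
    + saal_shift q u A B k j * saal_term q u A B k j"
proof -
  obtain m where k: "k = Suc (j + m)"
    using assms(2) less_iff_Suc_add by blast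
  define y z where "y = q ^ j" and "z = q ^ m"
  define C where "C = u * A * B"
  have y1: "1 - q * y \<noteq> 0" and z1: "1 - q * z \<noteq> 0"
    using power_ne_1_of_norm_ne_1[OF assms(1)] by (auto simp: y_def z_def)
  have nz: "qpoch q q i \<noteq> 0" for i
    using qpoch_self_nonzero[OF assms(1)] .
  \<comment> \<open>All three terms are multiples of this product, with explicit rational cofactors.\<close>
  define X where "X = qpoch q q k / (qpoch q q j * qpoch q q m) * u ^ j * qpoch A q j * qpoch B q j
    * qpoch (C * (q * y)) q m * qpoch u q m"
  have st: "saal_term q u A B k' i = qbinomial q k' i * u ^ i * qpoch A q i * qpoch B q i *
      qpoch (C * q ^ i) q (k' - i) * qpoch u q (k' - i)" for k' i
    by (simp add: saal_term_def C_def)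
  have low: "saal_term q u A B k j = X * (1 - C * y) * (1 - u * z) / (1 - q * z)"
    using nz z1 qpoch_Suc_left[of "C * y" q m]
    by (simp add: st qbinomial_def X_def k y_def[symmetric] z_def[symmetric]
        Suc_diff_le qpoch_Suc[of q q m] qpoch_Suc[of u q m] mult_ac)
  have mid: "saal_term q u A B k (Suc j) = X * u * (1 - A * y) * (1 - B * y) / (1 - q * y)"
    using nz y1
    by (simp add: st qbinomial_def X_def k y_def[symmetric] z_def[symmetric]
        qpoch_Suc[of _ q j] mult_ac)
  have high: "saal_term q u A B (Suc k) (Suc j) =
      X * u * (1 - A * y) * (1 - B * y) * (1 - q * (q * y * z))
        * (1 - C * (q * y * z)) * (1 - u * z) / ((1 - q * y) * (1 - q * z))"
    using nz y1 z1
    by (simp add: st qbinomial_def X_def k y_def[symmetric] z_def[symmetric]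
        qpoch_Suc[of _ q j] qpoch_Suc[of _ q m] qpoch_Suc[of q q "Suc (j + m)"]
        Suc_diff_le power_add mult_ac)
  have shifts: "saal_shift q u A B k j = q * z * u * (1 - A * y) * (1 - B * y)"
      "saal_shift q u A B k (Suc j) = z * u * (1 - A * (q * y)) * (1 - B * (q * y))"
    by (simp_all add: saal_shift_def k y_def z_def Suc_diff_le)
  have qk: "q ^ k = q * y * z"
    by (simp add: k y_def z_def power_add)
  have key: "(1 - q * (q * y * z)) * (1 - C * (q * y * z)) * (1 - u * z) =
      ((1 - u * A * (q * y * z)) * (1 - u * B * (q * y * z))
        - z * u * (1 - A * (q * y)) * (1 - B * (q * y))) * (1 - q * z)
      + q * z * (1 - C * y) * (1 - u * z) * (1 - q * y)"
    unfolding C_def by algebra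
  have "saal_term q u A B (Suc k) (Suc j) = X * u * (1 - A * y) * (1 - B * y)
      * ((1 - q * (q * y * z)) * (1 - C * (q * y * z)) * (1 - u * z)) / ((1 - q * y) * (1 - q * z))"
    by (simp add: high mult_ac)
  also have "\<dots> = ((1 - u * A * q ^ k) * (1 - u * B * q ^ k) - saal_shift q u A B k (Suc j))
      * saal_term q u A B k (Suc j) + saal_shift q u A B k j * saal_term q u A B k j"
    unfolding key low mid shifts qk using y1 z1
    by (simp add: divide_simps) algebra
  finally show ?thesis .
qed

text \<open>
  By the recurrence the contributions that the \<open>j\<close>-th summand makes at positions \<open>j\<close> and
  \<open>j + 1\<close> add up to \<open>(1 - u A q\<^sup>k) (1 - u B q\<^sup>k)\<close> times that summand, a factor that does not
  depend on \<open>j\<close>.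
\<close>

lemma q_saalschuetz:
  assumes "norm q \<noteq> 1"
  shows "(\<Sum>j\<le>k. saal_term q u A B k j) = qpoch (u * A) q k * qpoch (u * B) q k"
proof (induction k)
  case 0
  show ?case
    using assms by (simp add: saal_term_def)
next
  case (Suc k)
  define F where "F = (1 - u * A * q ^ k) * (1 - u * B * q ^ k)"
  define t s where "t = saal_term q u A B k" and "s = saal_shift q u A B k"
  have "(\<Sum>j\<le>Suc k. saal_term q u A B (Suc k) j) =
      saal_term q u A B (Suc k) 0 + (\<Sum>j<k. saal_term q u A B (Suc k) (Suc j))
      + saal_term q u A B (Suc k) (Suc k)"
    by (subst sum.atMost_Suc_shift) (simp add: lessThan_Suc_atMost[symmetric])
  also have "\<dots> = (F - s 0) * t 0 + (\<Sum>j<k. (F - s (Suc j)) * t (Suc j) + s j * t j) + s k * t k"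
    using assms by (simp add: saal_term_0 saal_term_Suc saal_term_top F_def s_def t_def)
  also have "\<dots> = (\<Sum>j<Suc k. (F - s j) * t j) + (\<Sum>j<Suc k. s j * t j)"
    by (subst sum.lessThan_Suc_shift) (simp add: sum.distrib)
  also have "\<dots> = F * (\<Sum>j\<le>k. t j)"
    by (simp add: sum.distrib[symmetric] algebra_simps sum_distrib_left lessThan_Suc_atMost
        del: sum.lessThan_Suc)
  finally show ?case
    using Suc.IH by (simp add: t_def F_def qpoch_Suc mult_ac)
qed

section \<open>Sears' transformation without denominators\<close>

definition sears_sum ::
  "complex \<Rightarrow> nat \<Rightarrow> complex \<Rightarrow> complex \<Rightarrow> complex \<Rightarrow> complex \<Rightarrow> complex \<Rightarrow> complex" where
  "sears_sum q n a c d e f =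
     (\<Sum>k\<le>n. qbinomial q n k * c ^ k * qpoch c q (n - k) *
        qpoch (a / (c * d)) q k * qpoch (a / (c * e)) q k * qpoch (a / (c * f)) q k *
        qpoch (a / c * q ^ k) q (n - k) * qpoch (a^2 / (c * d * e * f) * q ^ k) q (n - k))"

lemma sum_triangle_swap:
  fixes g :: "nat \<Rightarrow> nat \<Rightarrow> 'a :: comm_monoid_add"
  shows "(\<Sum>k\<le>n. \<Sum>j\<le>k. g k j) = (\<Sum>j\<le>n. \<Sum>i\<le>n - j. g (j + i) j)"
  unfolding sum.Sigma[OF finite_atMost ballI[OF finite_atMost]]
  by (rule sum.reindex_bij_witness[of _ "\<lambda>(j, i). (j + i, j)" "\<lambda>(k, j). (j, k - j)"]) auto

text \<open>
  The exchange of \<open>c\<close> and \<open>d\<close> is Sears' transformation. Both the expansion of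
  \<open>(a / (c e), a / (c f); q)\<^sub>k\<close> and the evaluation of the inner sum after interchanging the
  summations are instances of the Saalschuetz sum; in the first one the product \<open>u A B\<close> is the
  parameter \<open>a\<^sup>2 / (c d e f)\<close>, so that its shifted factorials combine to a factor that does not
  depend on \<open>k\<close>.
\<close>

lemma sears_sum_exchange:
  assumes "norm q \<noteq> 1" and "c \<noteq> 0" "d \<noteq> 0"
  shows "sears_sum q n a c d e f = sears_sum q n a d c e f"
proof -
  define D where "D = a^2 / (c * d * e * f)"
  define A B where "A = a / (d * e)" and "B = a / (d * f)"
  define r where "r = a / (c * d)"
  have D: "d / c * A * B = D"
    using assms by (simp add: A_def B_def D_def power2_eq_square)
  have expand: "qpoch (a / (c * e)) q k * qpoch (a / (c * f)) q k
      = (\<Sum>j\<le>k. saal_term q (d / c) A B k j)" for k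
    using assms by (simp add: q_saalschuetz A_def B_def)
  have inner: "(\<Sum>i\<le>m. saal_term q c (d / c) (r * q ^ j) m i)
      = qpoch d q m * qpoch (a / d * q ^ j) q m" for m j
    using assms by (simp add: q_saalschuetz r_def)
  have summand: "qbinomial q n (j + i) * c ^ (j + i) * qpoch c q (n - (j + i)) * qpoch r q (j + i) *
        qpoch (a / c * q ^ (j + i)) q (n - (j + i)) * qpoch (D * q ^ (j + i)) q (n - (j + i)) *
        saal_term q (d / c) A B (j + i) j
      = qbinomial q n j * d ^ j * qpoch r q j * qpoch A q j * qpoch B q j *
        qpoch (D * q ^ j) q (n - j) * saal_term q c (d / c) (r * q ^ j) (n - j) i"
    if le: "j \<le> n" "i \<le> n - j" for i j
  proof -
    have binom: "qbinomial q n (j + i) * qbinomial q (j + i) j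
        = qbinomial q n j * qbinomial q (n - j) i"
      using qbinomial_mult[OF assms(1)] .
    have pow: "c ^ (j + i) * (d / c) ^ j = d ^ j * c ^ i"
      using assms by (simp add: power_add power_divide)
    have D_split: "qpoch (D * q ^ j) q i * qpoch (D * q ^ (j + i)) q (n - (j + i))
        = qpoch (D * q ^ j) q (n - j)"
      using qpoch_split[of i "n - j" "D * q ^ j" q] le by (simp add: power_add mult_ac)
    have r_split: "qpoch r q (j + i) = qpoch r q j * qpoch (r * q ^ j) q i"
      by (rule qpoch_add)
    have arg: "c * (d / c) * (r * q ^ j) * q ^ i = a / c * q ^ (j + i)"
      using assms by (simp add: r_def power_add)
    have "qbinomial q n (j + i) * c ^ (j + i) * qpoch c q (n - (j + i)) * qpoch r q (j + i) *
        qpoch (a / c * q ^ (j + i)) q (n - (j + i)) * qpoch (D * q ^ (j + i)) q (n - (j + i)) *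
        saal_term q (d / c) A B (j + i) j
      = (qbinomial q n (j + i) * qbinomial q (j + i) j) * (c ^ (j + i) * (d / c) ^ j) *
        (qpoch (D * q ^ j) q i * qpoch (D * q ^ (j + i)) q (n - (j + i))) * qpoch r q (j + i) *
        qpoch c q (n - (j + i)) * qpoch (a / c * q ^ (j + i)) q (n - (j + i)) *
        qpoch A q j * qpoch B q j * qpoch (d / c) q i"
      unfolding saal_term_def D by (simp only: add_diff_cancel_left' mult_ac)
    also have "\<dots> = qbinomial q n j * d ^ j * qpoch r q j * qpoch A q j * qpoch B q j *
        qpoch (D * q ^ j) q (n - j) * saal_term q c (d / c) (r * q ^ j) (n - j) i"
      unfolding saal_term_def binom pow D_split r_split arg by (simp only: diff_diff_left mult_ac)
    finally show ?thesis .
  qed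
  have "sears_sum q n a c d e f =
      (\<Sum>k\<le>n. qbinomial q n k * c ^ k * qpoch c q (n - k) * qpoch r q k *
        qpoch (a / c * q ^ k) q (n - k) * qpoch (D * q ^ k) q (n - k) *
        (qpoch (a / (c * e)) q k * qpoch (a / (c * f)) q k))"
    by (simp add: sears_sum_def D_def r_def mult_ac)
  also have "\<dots> = (\<Sum>k\<le>n. \<Sum>j\<le>k. qbinomial q n k * c ^ k * qpoch c q (n - k) * qpoch r q k *
        qpoch (a / c * q ^ k) q (n - k) * qpoch (D * q ^ k) q (n - k) *
        saal_term q (d / c) A B k j)"
    unfolding expand by (simp add: sum_distrib_left)
  also have "\<dots> = (\<Sum>j\<le>n. \<Sum>i\<le>n - j. qbinomial q n j * d ^ j * qpoch r q j * qpoch A q j *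
        qpoch B q j * qpoch (D * q ^ j) q (n - j) * saal_term q c (d / c) (r * q ^ j) (n - j) i)"
    unfolding sum_triangle_swap by (intro sum.cong refl summand) auto
  also have "\<dots> = (\<Sum>j\<le>n. qbinomial q n j * d ^ j * qpoch r q j * qpoch A q j *
        qpoch B q j * qpoch (D * q ^ j) q (n - j) * (qpoch d q (n - j) * qpoch (a / d * q ^ j) q (n - j)))"
    by (simp only: sum_distrib_left[symmetric] inner)
  also have "\<dots> = sears_sum q n a d c e f"
    by (simp add: sears_sum_def D_def r_def A_def B_def mult_ac)
  finally show ?thesis .
qed

section \<open>Clearing the denominators of the series\<close>

text \<open>
  The \<open>i\<close>-th factor of \<open>(q\<^sup>1\<^sup>-\<^sup>n / c; q)\<^sub>k\<close> is a multiple of the \<open>i\<close>-th factor of \<open>(c; q)\<^sub>n\<close>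
  counted from the end. Once the powers of \<open>c\<close> are moved to the left, the accumulated constant
  does not depend on \<open>c\<close> and therefore cancels in a quotient of two such expressions; the case \<open>c = q\<close> covers the parameter \<open>q\<^sup>-\<^sup>n\<close>.
\<close>

lemma qpoch_reverse:
  assumes "q \<noteq> 0" "c \<noteq> 0" "k \<le> n"
  shows "qpoch (q powi (1 - int n) / c) q k * c ^ k * qpoch c q (n - k)
    = (\<Prod>i<k. - (q powi (1 - int n + int i))) * qpoch c q n"
  using \<open>k \<le> n\<close>
proof (induction k)
  case 0
  show ?case by simp
next
  case (Suc k)
  define p where "p = q powi (1 - int n + int k)"
  have p: "q powi (1 - int n) * q ^ k = p"
    using assms by (simp add: p_def power_int_add)
  have "p * q ^ (n - Suc k) = q powi (1 - int n + int k + int (n - Suc k))"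
    using assms unfolding p_def by (subst power_int_add) auto
  also have "\<dots> = 1"
    using Suc.prems by (simp add: of_nat_diff)
  finally have p1: "p * q ^ (n - Suc k) = 1" .
  have factor: "(1 - p / c) * c = - p * (1 - c * q ^ (n - Suc k))"
    using assms p1 by (simp add: algebra_simps)
  have tail: "qpoch c q (n - k) = qpoch c q (n - Suc k) * (1 - c * q ^ (n - Suc k))"
    using Suc.prems qpoch_Suc[of c q "n - Suc k"] by (simp add: Suc_diff_Suc)
  have "qpoch (q powi (1 - int n) / c) q (Suc k) * c ^ Suc k * qpoch c q (n - Suc k) =
      qpoch (q powi (1 - int n) / c) q k * c ^ k * qpoch c q (n - Suc k) * ((1 - p / c) * c)"
    using p by (simp add: qpoch_Suc mult_ac)
  also have "\<dots> = (qpoch (q powi (1 - int n) / c) q k * c ^ k * qpoch c q (n - k)) * (- p)"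
    unfolding factor tail by (simp only: mult_ac)
  also have "\<dots> = (\<Prod>i<Suc k. - (q powi (1 - int n + int i))) * qpoch c q n"
    using Suc by (simp add: p_def)
  finally show ?case .
qed

lemma qpoch_reverse_ratio:
  assumes "q \<noteq> 0" "norm q \<noteq> 1" "c \<noteq> 0" "k \<le> n" and nz: "qpoch c q n \<noteq> 0"
  shows "qpoch (q powi (- int n)) q k * q ^ k / (qpoch q q k * qpoch (q powi (1 - int n) / c) q k)
    = qbinomial q n k * c ^ k * qpoch c q (n - k) / qpoch c q n"
proof -
  define s where "s = (\<Prod>i<k. - (q powi (1 - int n + int i)))"
  have s: "s \<noteq> 0"
    using assms(1) by (simp add: s_def)
  have "q powi (1 - int n) / q = q powi (- int n)"
    using assms(1) by (simp add: power_int_diff power_int_minus field_simps)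
  then have num: "qpoch (q powi (- int n)) q k * q ^ k * qpoch q q (n - k) = s * qpoch q q n"
    using qpoch_reverse[OF assms(1,1,4)] by (simp add: s_def)
  have den: "qpoch (q powi (1 - int n) / c) q k * c ^ k * qpoch c q (n - k) = s * qpoch c q n"
    using qpoch_reverse[OF assms(1,3,4)] by (simp add: s_def)
  then have den_nz: "qpoch (q powi (1 - int n) / c) q k \<noteq> 0" "qpoch c q (n - k) \<noteq> 0"
    using s nz by auto
  have qnz: "qpoch q q i \<noteq> 0" for i
    using qpoch_self_nonzero[OF assms(2)] .
  have numerator: "qpoch (q powi (- int n)) q k * q ^ k = s * qpoch q q n / qpoch q q (n - k)"
    using num qnz by (simp add: field_simps)
  have denominator: "qpoch (q powi (1 - int n) / c) q k = s * qpoch c q n / (c ^ k * qpoch c q (n - k))"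
    using den den_nz assms(3) by (simp add: field_simps)
  show ?thesis
    unfolding numerator denominator qbinomial_def
    using s nz qnz den_nz(2) assms(3) by (simp add: divide_simps)
qed

text \<open>
  By the reversal, \<open>(q\<^sup>1\<^sup>-\<^sup>n / c; q)\<^sub>n\<close> and \<open>(c; q)\<^sub>n\<close> vanish for the same \<open>c \<noteq> 0\<close>, so the
  convention on the parameter \<open>q\<^sup>1\<^sup>-\<^sup>n / c\<close> allows division by \<open>(c; q)\<^sub>n\<close>.
\<close>

lemma denominators_ok_imp_nonzero:
  assumes "q \<noteq> 0" "c \<noteq> 0" and "denominators_ok n \<delta> (q powi (1 - int n) / c) \<zeta> q"
  shows "qpoch \<delta> q n \<noteq> 0" "qpoch c q n \<noteq> 0" "qpoch \<zeta> q n \<noteq> 0"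
proof -
  have "qpoch \<delta> q n \<noteq> 0 \<and> qpoch (q powi (1 - int n) / c) q n \<noteq> 0 \<and> qpoch \<zeta> q n \<noteq> 0"
    using assms(3) unfolding denominators_ok_def qpoch_nonzero_iff[OF assms(1)] by blast
  moreover from this have "qpoch c q n \<noteq> 0"
    using qpoch_reverse[OF assms(1,2), of n n] assms(1,2) by auto
  ultimately show "qpoch \<delta> q n \<noteq> 0" "qpoch c q n \<noteq> 0" "qpoch \<zeta> q n \<noteq> 0"
    by blast+
qed

lemma phi43_eq_sears_sum:
  assumes "q \<noteq> 0" "norm q \<noteq> 1" "c \<noteq> 0"
    and "denominators_ok n (a^2 / (c * d * e * f)) (q powi (1 - int n) / c) (a / c) q"
  shows "qpochs [a / c, c] q n * qpoch (a^2 / (c * d * e * f)) q n *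
      phi43 n (a / (c * d)) (a / (c * e)) (a / (c * f))
        (a^2 / (c * d * e * f)) (q powi (1 - int n) / c) (a / c) q q
    = sears_sum q n a c d e f"
proof -
  define D where "D = a^2 / (c * d * e * f)"
  have nz: "qpoch D q n \<noteq> 0" "qpoch c q n \<noteq> 0" "qpoch (a / c) q n \<noteq> 0"
    using denominators_ok_imp_nonzero[OF assms(1,3,4)] by (simp_all add: D_def)
  have "qpochs [a / c, c] q n * qpoch D q n *
      (qpochs [q powi (- int n), a / (c * d), a / (c * e), a / (c * f)] q k
        / qpochs [q, D, q powi (1 - int n) / c, a / c] q k * q ^ k) =
      qbinomial q n k * c ^ k * qpoch c q (n - k) *
        qpoch (a / (c * d)) q k * qpoch (a / (c * e)) q k * qpoch (a / (c * f)) q k *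
        qpoch (a / c * q ^ k) q (n - k) * qpoch (D * q ^ k) q (n - k)" (is "?lhs = ?rhs")
    if "k \<le> n" for k
  proof -
    define N where "N = qpoch (a / (c * d)) q k * qpoch (a / (c * e)) q k * qpoch (a / (c * f)) q k"
    have split: "qpoch (a / c) q n = qpoch (a / c) q k * qpoch (a / c * q ^ k) q (n - k)"
        "qpoch D q n = qpoch D q k * qpoch (D * q ^ k) q (n - k)"
      using qpoch_split[OF that] by blast+
    then have nz': "qpoch (a / c) q k \<noteq> 0" "qpoch D q k \<noteq> 0"
      using nz by auto
    have "?lhs = qpoch (a / c) q n * qpoch c q n * qpoch D q n * N / (qpoch D q k * qpoch (a / c) q k) *
        (qpoch (q powi (- int n)) q k * q ^ k / (qpoch q q k * qpoch (q powi (1 - int n) / c) q k))"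
      by (simp add: qpochs_def N_def mult_ac)
    also have "\<dots> = N * qpoch (a / c * q ^ k) q (n - k) * qpoch (D * q ^ k) q (n - k) *
        (qbinomial q n k * c ^ k * qpoch c q (n - k))"
      unfolding qpoch_reverse_ratio[OF assms(1-3) that nz(2)] split
      using nz(2) nz' by (simp add: field_simps)
    also have "\<dots> = ?rhs"
      by (simp add: N_def mult_ac)
    finally show ?thesis .
  qed
  then show ?thesis
    unfolding phi43_def sears_sum_def D_def[symmetric] sum_distrib_left
    by (intro sum.cong refl) auto
qed

text \<open>
  The factor \<open>(a\<^sup>2 / (c d e f); q)\<^sub>n\<close> is the same on both sides and nonzero by the convention on
  denominators, so cancelling it from the exchange identity leaves only the stated quotient.
\<close>

lemma sears_transformation:
  assumes "q \<noteq> 0" "norm q \<noteq> 1" "c \<noteq> 0" "d \<noteq> 0"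
    and "denominators_ok n (a^2 / (c * d * e * f)) (q powi (1 - int n) / c) (a / c) q"
    and "denominators_ok n (a^2 / (c * d * e * f)) (q powi (1 - int n) / d) (a / d) q"
  shows "phi43 n (a / (c * d)) (a / (c * e)) (a / (c * f))
      (a^2 / (c * d * e * f)) (q powi (1 - int n) / c) (a / c) q q
    = qpochs [a / d, d] q n / qpochs [a / c, c] q n *
      phi43 n (a / (d * c)) (a / (d * e)) (a / (d * f))
        (a^2 / (c * d * e * f)) (q powi (1 - int n) / d) (a / d) q q"
proof -
  have D: "a^2 / (d * c * e * f) = a^2 / (c * d * e * f)"
    by (simp add: mult_ac)
  note nz = denominators_ok_imp_nonzero[OF assms(1,3,5)]
  have "qpochs [a / c, c] q n \<noteq> 0"
    using nz by (simp add: qpochs_def)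
  moreover have "qpoch (a^2 / (c * d * e * f)) q n * (qpochs [a / c, c] q n *
      phi43 n (a / (c * d)) (a / (c * e)) (a / (c * f))
        (a^2 / (c * d * e * f)) (q powi (1 - int n) / c) (a / c) q q)
    = qpoch (a^2 / (c * d * e * f)) q n * (qpochs [a / d, d] q n *
      phi43 n (a / (d * c)) (a / (d * e)) (a / (d * f))
        (a^2 / (c * d * e * f)) (q powi (1 - int n) / d) (a / d) q q)"
    using phi43_eq_sears_sum[OF assms(1-3,5)]
      phi43_eq_sears_sum[OF assms(1,2,4), of n a c e f, unfolded D, OF assms(6)]
      sears_sum_exchange[OF assms(2-4), of n a e f]
    by (simp only: mult_ac)
  ultimately show ?thesis
    using nz(1) by (simp add: field_simps)
qed

theorem corollary3p10:
  fixes n :: nat and b c d e f q :: complex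
  assumes "b \<noteq> 0" "c \<noteq> 0" "d \<noteq> 0" "e \<noteq> 0" "f \<noteq> 0" "q \<noteq> 0"
    and "norm q \<noteq> 1"
    and "denominators_ok n (q^2 * b^2 / (c * d * e * f)) (q powi (1 - int n) / c) (q * b / c) q"
    and "denominators_ok n (q^2 * b^2 / (c * d * e * f)) (q powi (1 - int n) / d) (q * b / d) q"
    and "denominators_ok n (q^2 * b^2 / (c * d * e * f)) (q powi (1 - int n) / e) (q * b / e) q"
    and "denominators_ok n (q^2 * b^2 / (c * d * e * f)) (q powi (1 - int n) / f) (q * b / f) q"
    and "qpochs [q * b / c, c] q n \<noteq> 0"
  shows
    "phi43 n (q * b / (c * d)) (q * b / (c * e)) (q * b / (c * f))
       (q^2 * b^2 / (c * d * e * f)) (q powi (1 - int n) / c) (q * b / c) q q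
     = qpochs [q * b / d, d] q n / qpochs [q * b / c, c] q n *
       phi43 n (q * b / (d * c)) (q * b / (d * e)) (q * b / (d * f))
         (q^2 * b^2 / (c * d * e * f)) (q powi (1 - int n) / d) (q * b / d) q q
   \<and> phi43 n (q * b / (c * d)) (q * b / (c * e)) (q * b / (c * f))
       (q^2 * b^2 / (c * d * e * f)) (q powi (1 - int n) / c) (q * b / c) q q
     = qpochs [q * b / e, e] q n / qpochs [q * b / c, c] q n *
       phi43 n (q * b / (e * c)) (q * b / (e * d)) (q * b / (e * f))
         (q^2 * b^2 / (c * d * e * f)) (q powi (1 - int n) / e) (q * b / e) q q
   \<and> phi43 n (q * b / (c * d)) (q * b / (c * e)) (q * b / (c * f))
       (q^2 * b^2 / (c * d * e * f)) (q powi (1 - int n) / c) (q * b / c) q q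
     = qpochs [q * b / f, f] q n / qpochs [q * b / c, c] q n *
       phi43 n (q * b / (f * c)) (q * b / (f * d)) (q * b / (f * e))
         (q^2 * b^2 / (c * d * e * f)) (q powi (1 - int n) / f) (q * b / f) q q"
proof -
  have sq: "q^2 * b^2 = (q * b)^2"
    by (simp add: power_mult_distrib)
  have perm_e: "c * e * d * f = c * d * e * f" and perm_f: "c * f * d * e = c * d * e * f"
    by (simp_all add: mult_ac)
  have swap_phi: "phi43 n \<beta> \<alpha> \<gamma> \<delta> \<epsilon> \<zeta> q q = phi43 n \<alpha> \<beta> \<gamma> \<delta> \<epsilon> \<zeta> q q"
      "phi43 n \<gamma> \<alpha> \<beta> \<delta> \<epsilon> \<zeta> q q = phi43 n \<alpha> \<beta> \<gamma> \<delta> \<epsilon> \<zeta> q q" for \<alpha> \<beta> \<gamma> \<delta> \<epsilon> \<zeta>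
    by (simp_all add: phi43_def qpochs_def mult_ac)
  note ok = assms(8-11)[unfolded sq]
  show ?thesis
    unfolding sq
    using sears_transformation[OF assms(6,7,2,3) ok(1,2)]
      sears_transformation[OF assms(6,7,2,4), of n "q * b" d f, unfolded perm_e, OF ok(1,3)]
      sears_transformation[OF assms(6,7,2,5), of n "q * b" d e, unfolded perm_f, OF ok(1,4)]
    by (simp only: swap_phi(1)[where \<alpha> = "q * b / (c * d)" and \<beta> = "q * b / (c * e)"]
        swap_phi(2)[where \<alpha> = "q * b / (c * d)" and \<beta> = "q * b / (c * e)"])
qed

end
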